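(* Let $G$ be a finite connected graph and let $L\subseteq G$ be a subgraph. Then $L$ is categorical in $G$ if and only if $L$ is a forest.
   Context: Graphs are simple and nonempty, and are regarded as abstract simplicial complexes of dimension at most one; subgraphs are subcomplexes. A forest is a graph without cycles. Two simplicial maps $\varphi,\psi\colon K\to M$ between abstract simplicial complexes are contiguous, $\varphi\sim_c\psi$, if for every simplex $\sigma$ of $K$ the set of vertices $\varphi(\sigma)\cup\psi(\sigma)$ is a simplex of $M$. They are in the same contiguity class, $\varphi\sim\psi$, if there is a finite sequence of simplicial maps $\varphi=\varphi_1\sim_c\varphi_2\sim_c\cdots\sim_c\varphi_m=\psi$ from $K$ to $M$. A subcomplex $U\subset K$ is categorical (in $K$) if there is a vertex $v\in K$ such that the inclusion $U\to K$ and the constant map $c_v\colon U\to K$ with value $v$ are in the same contiguity class. *)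

theory Defs
  imports Main
begin

definition abstract_complex :: "'a set set \<Rightarrow> bool" where
  "abstract_complex K \<longleftrightarrow>
     (\<forall>\<sigma>\<in>K. finite \<sigma> \<and> \<sigma> \<noteq> {}) \<and>
     (\<forall>\<sigma>\<in>K. \<forall>\<tau>. \<tau> \<subseteq> \<sigma> \<and> \<tau> \<noteq> {} \<longrightarrow> \<tau> \<in> K)"

definition vertex_set :: "'a set set \<Rightarrow> 'a set" where
  "vertex_set K = \<Union>K"

definition subcomplex :: "'a set set \<Rightarrow> 'a set set \<Rightarrow> bool" where
  "subcomplex U K \<longleftrightarrow> abstract_complex U \<and> U \<subseteq> K"

(* Maps are total functions on the type of vertices; only their values on vertex_set K
   matter, since maps agreeing there are contiguous as soon as one of them is simplicial. *)
definition simplicial_vertex_map :: "'a set set \<Rightarrow> 'b set set \<Rightarrow> ('a \<Rightarrow> 'b) \<Rightarrow> bool" where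
  "simplicial_vertex_map K M f \<longleftrightarrow> (\<forall>\<sigma>\<in>K. f ` \<sigma> \<in> M)"

definition contiguous :: "'a set set \<Rightarrow> 'b set set \<Rightarrow> ('a \<Rightarrow> 'b) \<Rightarrow> ('a \<Rightarrow> 'b) \<Rightarrow> bool" where
  "contiguous K M f g \<longleftrightarrow>
     simplicial_vertex_map K M f \<and> simplicial_vertex_map K M g \<and>
     (\<forall>\<sigma>\<in>K. f ` \<sigma> \<union> g ` \<sigma> \<in> M)"

definition same_contiguity_class ::
    "'a set set \<Rightarrow> 'b set set \<Rightarrow> ('a \<Rightarrow> 'b) \<Rightarrow> ('a \<Rightarrow> 'b) \<Rightarrow> bool" where
  "same_contiguity_class K M f g \<longleftrightarrow>
     simplicial_vertex_map K M f \<and> simplicial_vertex_map K M g \<and> (contiguous K M)\<^sup>*\<^sup>* f g"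

definition categorical_in :: "'a set set \<Rightarrow> 'a set set \<Rightarrow> bool" where
  "categorical_in U K \<longleftrightarrow>
     subcomplex U K \<and>
     (\<exists>v\<in>vertex_set K. same_contiguity_class U K (\<lambda>x. x) (\<lambda>x. v))"

definition graph_complex :: "'a set set \<Rightarrow> bool" where
  "graph_complex G \<longleftrightarrow> abstract_complex G \<and> G \<noteq> {} \<and> (\<forall>\<sigma>\<in>G. card \<sigma> \<le> 2)"

definition adjacent_in :: "'a set set \<Rightarrow> 'a \<Rightarrow> 'a \<Rightarrow> bool" where
  "adjacent_in G x y \<longleftrightarrow> x \<noteq> y \<and> {x, y} \<in> G"

definition connected_graph :: "'a set set \<Rightarrow> bool" where
  "connected_graph G \<longleftrightarrow>
     graph_complex G \<and> (\<forall>x\<in>vertex_set G. \<forall>y\<in>vertex_set G. (adjacent_in G)\<^sup>*\<^sup>* x y)"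

(* A cycle is given by its pairwise distinct vertices in cyclic order. *)
definition graph_cycle :: "'a set set \<Rightarrow> 'a list \<Rightarrow> bool" where
  "graph_cycle G xs \<longleftrightarrow>
     length xs \<ge> 3 \<and> distinct xs \<and>
     successively (adjacent_in G) xs \<and> adjacent_in G (last xs) (hd xs)"

definition forest_graph :: "'a set set \<Rightarrow> bool" where
  "forest_graph G \<longleftrightarrow> graph_complex G \<and> (\<nexists>xs. graph_cycle G xs)"

end

theory Submission
  imports Defs
begin

text \<open>
  A cycle is rigid: in a graph, if \<open>f\<close> fixes a vertex \<open>x\<close> and two distinct neighbours \<open>u\<close>, \<open>w\<close> of it,
  any map contiguous to \<open>f\<close> sends \<open>x\<close> into the intersection \<open>{x}\<close> of the edges \<open>{x, u}\<close> and \<open>{x, w}\<close>.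
  Hence every map in the contiguity class of the inclusion fixes all vertices of a cycle, and a
  constant map does not. Conversely, any two simplicial maps from a finite forest to a connected
  graph are in the same contiguity class, by induction on the vertices: a leaf can be folded onto
  its neighbour, and an isolated vertex can be moved along a path.
\<close>

section \<open>Simplices, adjacency and contiguity\<close>

lemma vertex_set_singleton:
  assumes "abstract_complex K"
  shows "v \<in> vertex_set K \<longleftrightarrow> {v} \<in> K"
proof
  assume "v \<in> vertex_set K"
  then obtain \<sigma> where "\<sigma> \<in> K" "{v} \<subseteq> \<sigma>" unfolding vertex_set_def by blast
  then show "{v} \<in> K" using assms unfolding abstract_complex_def by (meson insert_not_empty)
qed (auto simp: vertex_set_def)

lemma adjacent_in_simplex:
  assumes "abstract_complex K" "\<sigma> \<in> K" "x \<in> \<sigma>" "y \<in> \<sigma>" "x \<noteq> y"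
  shows "adjacent_in K x y"
  using assms unfolding abstract_complex_def adjacent_in_def
  by (metis empty_subsetI insert_not_empty insert_subset)

lemma adjacent_in_sym: "adjacent_in K x y \<Longrightarrow> adjacent_in K y x"
  by (auto simp: adjacent_in_def insert_commute)

lemma adjacent_in_vertex: "adjacent_in K x y \<Longrightarrow> x \<in> vertex_set K \<and> y \<in> vertex_set K"
  unfolding adjacent_in_def vertex_set_def by blast

text \<open>Serves to transport chains: a chain of contiguities through precomposition or through an
  update at one vertex, and a path in the target graph into a chain of maps.\<close>

lemma rtranclp_image:
  assumes "R\<^sup>*\<^sup>* x y" "\<And>x y. R x y \<Longrightarrow> S (h x) (h y)"
  shows "S\<^sup>*\<^sup>* (h x) (h y)"
  using assms(1)
proof (induction rule: rtranclp_induct)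
  case (step y z)
  then show ?case using assms(2) by (meson rtranclp.rtrancl_into_rtrancl)
qed simp

lemma contiguous_sym: "contiguous K M f g \<Longrightarrow> contiguous K M g f"
  unfolding contiguous_def by (simp add: Un_commute)

lemma contiguous_comp:
  assumes "contiguous K M f g" "simplicial_vertex_map J K r"
  shows "contiguous J M (f \<circ> r) (g \<circ> r)"
  using assms unfolding contiguous_def simplicial_vertex_map_def image_comp[symmetric] by blast

section \<open>Cycles and their rigidity under contiguity\<close>

lemma graph_cycle_rotate:
  assumes "graph_cycle K (xs @ ys)"
  shows "graph_cycle K (ys @ xs)"
  using assms unfolding graph_cycle_def
  by (cases "xs = []"; cases "ys = []") (auto simp: successively_append_iff)

text \<open>After rotating the cycle so that \<open>x\<close> comes first, its neighbours are the
  second and the last entry, which differ because there are at least three vertices.\<close>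

lemma graph_cycle_two_neighbours:
  assumes "graph_cycle K xs" "x \<in> set xs"
  obtains u w where "u \<in> set xs" "w \<in> set xs" "u \<noteq> w" "adjacent_in K x u" "adjacent_in K x w"
proof -
  obtain as bs where xs: "xs = as @ x # bs" using assms(2) by (meson split_list)
  have c: "graph_cycle K (x # bs @ as)"
    using graph_cycle_rotate[of K as "x # bs"] assms(1) xs by simp
  then obtain u zs where zs: "bs @ as = u # zs" "zs \<noteq> []"
    by (cases "bs @ as") (auto simp: graph_cycle_def Suc_le_eq)
  have *: "set (bs @ as) \<subseteq> set xs" using xs by auto
  have "adjacent_in K x u" "adjacent_in K (last zs) x" "u \<noteq> last zs" "last zs \<in> set zs"
    using c zs by (auto simp: graph_cycle_def)
  moreover have "u \<in> set xs" "last zs \<in> set xs"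
    using * zs \<open>last zs \<in> set zs\<close> by auto
  ultimately show thesis using that adjacent_in_sym by metis
qed

lemma graph_contiguous_fixes_vertex:
  assumes "contiguous L G f g" "graph_complex G"
    and "adjacent_in L x u" "adjacent_in L x w" "u \<noteq> w" "f x = x" "f u = u" "f w = w"
  shows "g x = x"
proof -
  have edge: "g x \<in> {x, y}" if "adjacent_in L x y" "f y = y" for y
  proof -
    have "f ` {x, y} \<union> g ` {x, y} \<in> G" "x \<noteq> y"
      using assms(1) that unfolding contiguous_def adjacent_in_def by blast+
    \<comment> \<open>As \<open>f\<close> fixes both ends of the edge, this simplex contains the
      two-element set \<open>{x, y}\<close>; having at most two vertices, it equals that
      set.\<close>
    then have "{x, y} \<union> {g x, g y} \<in> G" using that assms(6) by simp
    then have "finite ({x, y} \<union> {g x, g y})" "card ({x, y} \<union> {g x, g y}) \<le> 2"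
      using assms(2) unfolding graph_complex_def by blast+
    then have "{x, y} = {x, y} \<union> {g x, g y}"
      using \<open>x \<noteq> y\<close> by (intro card_seteq) auto
    then show ?thesis by blast
  qed
  show ?thesis
    using edge[OF assms(3,7)] edge[OF assms(4,8)] assms(5) by auto
qed

lemma contiguity_class_fixes_cycle:
  assumes "(contiguous L G)\<^sup>*\<^sup>* (\<lambda>x. x) g" "graph_complex G" "graph_cycle L xs" "x \<in> set xs"
  shows "g x = x"
  using assms(1,4)
\<comment> \<open>The vertex is generalised because the step uses the claim for \<open>f\<close> at
  \<open>x\<close> and at both of its neighbours on the cycle.\<close>
proof (induction arbitrary: x rule: rtranclp_induct)
  case base
  show ?case by simp
next
  case (step f g)
  then show ?case
    using graph_cycle_two_neighbours[OF assms(3) step.prems]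
      graph_contiguous_fixes_vertex[OF step.hyps(2) assms(2)] by metis
qed

section \<open>Leaves and the contraction of forests\<close>

text \<open>Take a longest path. By maximality all neighbours of its first vertex lie on it, and one
  beyond the second vertex would close a cycle. The vertex found may also be isolated.\<close>

lemma acyclic_complex_has_leaf:
  assumes "finite (vertex_set L)" "vertex_set L \<noteq> {}" "\<nexists>xs. graph_cycle L xs"
  obtains v where "v \<in> vertex_set L"
    "\<And>u w. adjacent_in L v u \<Longrightarrow> adjacent_in L v w \<Longrightarrow> u = w"
proof -
  define P where "P xs \<longleftrightarrow> xs \<noteq> [] \<and> distinct xs \<and> successively (adjacent_in L) xs
    \<and> set xs \<subseteq> vertex_set L" for xs
  obtain v where "v \<in> vertex_set L" using assms(2) by blast
  then have "P [v]" by (simp add: P_def)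
  moreover have "\<forall>xs. P xs \<longrightarrow> length xs < Suc (card (vertex_set L))"
    using assms(1) by (metis P_def card_mono distinct_card le_imp_less_Suc)
  ultimately obtain xs where xs: "P xs" and max: "\<And>ys. P ys \<Longrightarrow> length ys \<le> length xs"
    using ex_has_greatest_nat[of P "[v]" length "Suc (card (vertex_set L))"] by metis
  obtain x zs where zs: "xs = x # zs" using xs by (cases xs) (auto simp: P_def)
  have only: "zs \<noteq> [] \<and> u = hd zs" if u: "adjacent_in L x u" for u
  proof -
    have "u \<in> set xs"
    proof (rule ccontr)
      assume "u \<notin> set xs"
      then have "P (u # xs)"
        using xs adjacent_in_sym[OF u] adjacent_in_vertex[OF u] zs by (simp add: P_def)
      then show False using max by fastforce
    qed
    moreover have "u \<noteq> x" using u by (auto simp: adjacent_in_def)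
    ultimately have "u \<in> set zs" using zs by simp
    then obtain as bs where s: "zs = as @ u # bs" by (meson split_list)
    have "as = []"
    proof (rule ccontr)
      assume "as \<noteq> []"
      have "xs = (x # as @ [u]) @ bs" using zs s by simp
      then have "successively (adjacent_in L) (x # as @ [u])" "distinct (x # as @ [u])"
        using xs unfolding P_def by (metis successively_append_iff, metis distinct_append)
      then have "graph_cycle L (x # as @ [u])"
        using \<open>as \<noteq> []\<close> adjacent_in_sym[OF u] by (cases as) (auto simp: graph_cycle_def)
      then show False using assms(3) by blast
    qed
    then show ?thesis using s by simp
  qed
  show thesis
  proof (rule that)
    show "x \<in> vertex_set L" using xs zs by (simp add: P_def)
  qed (metis only)
qed

text \<open>A simplex containing the leaf \<open>v\<close> lies in the edge \<open>{v, w}\<close>,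
  so its images under the two maps together form the image of that edge. On all other simplices the
  maps agree.\<close>

lemma fold_leaf_contiguous:
  assumes "abstract_complex L" "adjacent_in L v w" "\<And>u. adjacent_in L v u \<Longrightarrow> u = w"
    and "simplicial_vertex_map L M f"
  shows "contiguous L M f (f \<circ> id(v := w))"
proof -
  have "f ` \<sigma> \<in> M \<and> (f \<circ> id(v := w)) ` \<sigma> \<in> M \<and> f ` \<sigma> \<union> (f \<circ> id(v := w)) ` \<sigma> \<in> M" if "\<sigma> \<in> L" for \<sigma>
  proof (cases "v \<in> \<sigma>")
    case True
    then have "\<sigma> \<subseteq> {v, w}"
      using adjacent_in_simplex[OF assms(1) that True] assms(3) by blast
    then have "(f \<circ> id(v := w)) ` \<sigma> = f ` {w}" "f ` \<sigma> \<union> (f \<circ> id(v := w)) ` \<sigma> = f ` {v, w}"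
      using True assms(2) by (auto simp: adjacent_in_def)
    moreover have "{w} \<in> L" "{v, w} \<in> L"
      using assms(1,2) adjacent_in_vertex[OF assms(2)]
      by (auto simp: vertex_set_singleton adjacent_in_def)
    ultimately show ?thesis
      using assms(4) that unfolding simplicial_vertex_map_def by metis
  next
    case False
    then have "(f \<circ> id(v := w)) ` \<sigma> = f ` \<sigma>" by (intro image_cong) auto
    then show ?thesis using assms(4) that unfolding simplicial_vertex_map_def by simp
  qed
  then show ?thesis unfolding contiguous_def simplicial_vertex_map_def by blast
qed

text \<open>No simplex other than \<open>{v}\<close> contains \<open>v\<close>, so the value there
  is independent of the rest. The case \<open>a = b\<close> lifts a chain from the deletion of
  \<open>v\<close>; the case \<open>f = g\<close> moves the value at \<open>v\<close> across an
  edge.\<close>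

lemma contiguous_extend_isolated:
  assumes "abstract_complex L" "\<And>u. \<not> adjacent_in L v u"
    and "contiguous {\<sigma> \<in> L. v \<notin> \<sigma>} M f g" "{a} \<in> M" "{b} \<in> M" "{a, b} \<in> M"
  shows "contiguous L M (f(v := a)) (g(v := b))"
proof -
  have "(f(v := a)) ` \<sigma> \<in> M \<and> (g(v := b)) ` \<sigma> \<in> M \<and> (f(v := a)) ` \<sigma> \<union> (g(v := b)) ` \<sigma> \<in> M"
    if "\<sigma> \<in> L" for \<sigma>
  proof (cases "v \<in> \<sigma>")
    case True
    then have "\<sigma> = {v}" using adjacent_in_simplex[OF assms(1) that True] assms(2) by blast
    then show ?thesis using assms(4-6) by (simp add: insert_commute)
  next
    case False
    then have "(f(v := a)) ` \<sigma> = f ` \<sigma>" "(g(v := b)) ` \<sigma> = g ` \<sigma>" by (auto intro!: image_cong)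
    then show ?thesis using assms(3) that False
      unfolding contiguous_def simplicial_vertex_map_def by simp
  qed
  then show ?thesis unfolding contiguous_def simplicial_vertex_map_def by blast
qed

text \<open>Arbitrary maps replace the inclusion and the constant map so that the induction can pass
  to smaller complexes; deleting vertices ends at the empty complex, hence
  \<open>abstract_complex\<close> rather than \<open>graph_complex\<close>.\<close>

lemma forest_maps_same_class:
  assumes "connected_graph G" "abstract_complex L" "finite (vertex_set L)" "\<nexists>xs. graph_cycle L xs"
    and "simplicial_vertex_map L G f" "simplicial_vertex_map L G g"
  shows "(contiguous L G)\<^sup>*\<^sup>* f g"
  using assms(2-6)
proof (induction "card (vertex_set L)" arbitrary: L f g rule: less_induct)
  case less
  have G: "abstract_complex G"
    using assms(1) by (simp add: connected_graph_def graph_complex_def)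
  show ?case
  proof (cases "vertex_set L = {}")
    case True
    then have "L = {}"
      using less.prems(1) unfolding vertex_set_def abstract_complex_def by auto
    then have "contiguous L G f g" by (simp add: contiguous_def simplicial_vertex_map_def)
    then show ?thesis by blast
  next
    case False
    obtain v where v: "v \<in> vertex_set L"
      and leaf: "\<And>u w. adjacent_in L v u \<Longrightarrow> adjacent_in L v w \<Longrightarrow> u = w"
      using acyclic_complex_has_leaf[OF less.prems(2) False less.prems(3)] by metis
    define L' where "L' = {\<sigma> \<in> L. v \<notin> \<sigma>}"
    have L': "abstract_complex L'"
      using less.prems(1) unfolding abstract_complex_def L'_def by blast
    have sub: "vertex_set L' \<subset> vertex_set L"
      using v unfolding vertex_set_def L'_def by blast
    have acyclic: "\<nexists>xs. graph_cycle L' xs"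
    proof
      assume "\<exists>xs. graph_cycle L' xs"
      then obtain xs where "graph_cycle L' xs" ..
      moreover have "adjacent_in L x y" if "adjacent_in L' x y" for x y
        using that by (simp add: adjacent_in_def L'_def)
      ultimately have "graph_cycle L xs"
        unfolding graph_cycle_def by (metis successively_mono)
      then show False using less.prems(3) by blast
    qed
    have simp': "simplicial_vertex_map L' G h" if "simplicial_vertex_map L G h" for h
      using that by (simp add: simplicial_vertex_map_def L'_def)
    \<comment> \<open>This chain controls the maps on \<open>L'\<close> only; the two cases below
      extend it over \<open>v\<close>.\<close>
    have IH: "(contiguous L' G)\<^sup>*\<^sup>* f g"
      using less.hyps[OF psubset_card_mono[OF less.prems(2) sub] L' _ acyclic simp' simp']
        less.prems finite_subset sub by blast
    show ?thesis
    proof (cases "\<exists>w. adjacent_in L v w")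
      case True
      then obtain w where w: "adjacent_in L v w" ..
      \<comment> \<open>This retraction sends \<open>L\<close> into \<open>L'\<close>, so
        precomposing with it turns the chain on \<open>L'\<close> into one on \<open>L\<close>; two
        folds join its ends to \<open>f\<close> and \<open>g\<close>.\<close>
      let ?r = "id(v := w)"
      have fold: "contiguous L G h (h \<circ> ?r)" if "simplicial_vertex_map L G h" for h
        using fold_leaf_contiguous[OF less.prems(1) w leaf[OF _ w] that] by blast
      have "simplicial_vertex_map L L id" by (simp add: simplicial_vertex_map_def)
      then have "simplicial_vertex_map L L ?r"
        using fold_leaf_contiguous[OF less.prems(1) w leaf[OF _ w], of L id]
        by (simp add: contiguous_def)
      moreover have "v \<notin> ?r ` \<sigma>" for \<sigma> using w by (auto simp: adjacent_in_def)
      ultimately have "simplicial_vertex_map L L' ?r"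
        unfolding simplicial_vertex_map_def L'_def by blast
      then have "(contiguous L G)\<^sup>*\<^sup>* (f \<circ> ?r) (g \<circ> ?r)"
        using rtranclp_image[OF IH, of "contiguous L G" "\<lambda>h. h \<circ> ?r"] contiguous_comp by blast
      then show ?thesis
        using fold[OF less.prems(4)] contiguous_sym[OF fold[OF less.prems(5)]]
        by (meson converse_rtranclp_into_rtranclp rtranclp.rtrancl_into_rtrancl)
    next
      case False
      have "{v} \<in> L" using v vertex_set_singleton[OF less.prems(1)] by blast
      then have fg: "{f v} \<in> G" "{g v} \<in> G"
        using less.prems(4,5) unfolding simplicial_vertex_map_def by force+
      \<comment> \<open>First the map changes away from \<open>v\<close> with the value
        \<open>f v\<close> held there; then that value travels along a path in \<open>G\<close> to
        \<open>g v\<close>.\<close>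
      have "(contiguous L G)\<^sup>*\<^sup>* (f(v := f v)) (g(v := f v))"
        using rtranclp_image[OF IH, of "contiguous L G" "\<lambda>h. h(v := f v)"]
          contiguous_extend_isolated[OF less.prems(1), of v G _ _ "f v" "f v"] False fg
        by (simp add: L'_def)
      moreover have "(adjacent_in G)\<^sup>*\<^sup>* (f v) (g v)"
        using assms(1) fg vertex_set_singleton[OF G] unfolding connected_graph_def by blast
      then have "(contiguous L G)\<^sup>*\<^sup>* (g(v := f v)) (g(v := g v))"
      proof (rule rtranclp_image)
        fix a b
        assume ab: "adjacent_in G a b"
        then have "{a} \<in> G" "{b} \<in> G" "{a, b} \<in> G"
          using adjacent_in_vertex[OF ab] vertex_set_singleton[OF G]
          by (auto simp: adjacent_in_def)
        moreover have "contiguous L' G g g"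
          using simp'[OF less.prems(5)] by (simp add: contiguous_def simplicial_vertex_map_def)
        ultimately show "contiguous L G (g(v := a)) (g(v := b))"
          using contiguous_extend_isolated[OF less.prems(1), of v G g g a b] False by (simp add: L'_def)
      qed
      ultimately show ?thesis by simp
    qed
  qed
qed

theorem theorem8p2p2:
  fixes G L :: "'a set set"
  assumes "connected_graph G" and "finite (vertex_set G)"
    and "graph_complex L" and "subcomplex L G"
  shows "categorical_in L G \<longleftrightarrow> forest_graph L"
proof
  have G: "graph_complex G" using assms(1) by (simp add: connected_graph_def)
  assume "categorical_in L G"
  then obtain v where chain: "(contiguous L G)\<^sup>*\<^sup>* (\<lambda>x. x) (\<lambda>x. v)"
    unfolding categorical_in_def same_contiguity_class_def by blast
  have "\<not> graph_cycle L xs" for xs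
  proof
    assume c: "graph_cycle L xs"
    \<comment> \<open>Rigidity would make every vertex of the cycle equal to \<open>v\<close>, yet a
      cycle has distinct vertices.\<close>
    then have "v = x" if "x \<in> set xs" for x
      using contiguity_class_fixes_cycle[OF chain G c that] by simp
    moreover obtain x where "x \<in> set xs" using c by (cases xs) (auto simp: graph_cycle_def)
    ultimately show False using graph_cycle_two_neighbours[OF c] by metis
  qed
  then show "forest_graph L" using assms(3) by (simp add: forest_graph_def)
next
  assume forest: "forest_graph L"
  have G: "abstract_complex G" "G \<noteq> {}"
    using assms(1) by (auto simp: connected_graph_def graph_complex_def)
  have L: "abstract_complex L" "L \<subseteq> G" using assms(4) by (auto simp: subcomplex_def)
  then have fin: "finite (vertex_set L)"
    using assms(2) by (auto simp: vertex_set_def intro: finite_subset)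
  obtain v where v: "v \<in> vertex_set G"
    using G unfolding abstract_complex_def vertex_set_def by (metis Union_iff all_not_in_conv)
  \<comment> \<open>Nonemptiness makes the constant map send each simplex to exactly
    \<open>{v}\<close>.\<close>
  have "\<sigma> \<noteq> {}" if "\<sigma> \<in> L" for \<sigma> using L(1) that by (auto simp: abstract_complex_def)
  then have "simplicial_vertex_map L G (\<lambda>x. x)" "simplicial_vertex_map L G (\<lambda>x. v)"
    using L v vertex_set_singleton[OF G(1)] by (auto simp: simplicial_vertex_map_def image_constant_conv)
  moreover from this have "(contiguous L G)\<^sup>*\<^sup>* (\<lambda>x. x) (\<lambda>x. v)"
    using forest forest_maps_same_class[OF assms(1) L(1) fin] by (simp add: forest_graph_def)
  ultimately show "categorical_in L G"
    using v assms(4) unfolding categorical_in_def same_contiguity_class_def by blast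
qed

end
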